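(* Let $p,n\in\mathbb{N}$ with $p,n\ge1$, and $r\in\mathbb{N}$ with $r\le p$, and assume $n\ge\max\{p+1,\;p+\lfloor p/2\rfloor-1\}$. Then $$X^{p,r,0}=(n+1)^{2r-1}\big(T_n^{\bm\alpha}-H_n^{\bm\alpha,2}\big),$$ where $\bm\alpha=(\alpha_0,\dots,\alpha_p)$ is given by $\alpha_k=(-1)^r\mathcal{N}_{2p+1}^{(2r)}(p+1-k)$, $k=0,\dots,p$.
   Context: Cardinal B-spline: $\mathcal{N}_0(t)=1$ for $t\in[0,1)$, $0$ otherwise; $\mathcal{N}_p(t)=\frac{t}{p}\mathcal{N}_{p-1}(t)+\frac{p+1-t}{p}\mathcal{N}_{p-1}(t-1)$, $p\ge1$ (support $[0,p+1]$, piecewise polynomial with integer breakpoints, $C^{p-1}$); $\mathcal{N}_{2p+1}\in C^{2p}$ so $\mathcal{N}_{2p+1}^{(2r)}$ is defined for $r\le p$. Dirichlet basis: for $c\in\mathbb{R}$ put $B^{D}_c(x)=\mathcal{N}_p\big((n+1)x-c+\tfrac{p+1}{2}\big)$ and for $i=1,\dots,n$, $x\in[0,1]$, $N^p_{i,0}(x)=\sum_{m\in\mathbb{Z}}\big(B^{D}_{i+2m(n+1)}(x)-B^{D}_{-i+2m(n+1)}(x)\big)$. $X^{p,r,0}_{i,j}=\int_0^1 (N^p_{i,0})^{(r)}(N^p_{j,0})^{(r)}\,\mathrm{d}x$ ($r=0$ gives the mass matrix, $r=1$ the stiffness matrix). For $\bm\alpha\in\mathbb{R}^{p+1}$ and $n\ge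 p+1$, with the convention $\alpha_k=0$ for $k>p$: $T_n^{\bm\alpha}$ is the $n\times n$ symmetric banded Toeplitz matrix with $(T_n^{\bm\alpha})_{i,j}=\alpha_{|i-j|}$; $H_n^{\bm\alpha,2}$ is the $n\times n$ Hankel-type matrix with $(H_n^{\bm\alpha,2})_{i,j}=\alpha_{i+j}+\alpha_{2n+2-i-j}$. *)

theory Defs
  imports "HOL-Analysis.Analysis"
begin

fun cardN :: "nat \<Rightarrow> real \<Rightarrow> real" where
  "cardN 0 t = (if 0 \<le> t \<and> t < 1 then 1 else 0)"
| "cardN (Suc p) t =
     t / real (Suc p) * cardN p t
     + (real (Suc p) + 1 - t) / real (Suc p) * cardN p (t - 1)"

definition BD :: "nat \<Rightarrow> nat \<Rightarrow> real \<Rightarrow> real \<Rightarrow> real" where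
  "BD p n c x = cardN p (real (n + 1) * x - c + (real p + 1) / 2)"

text \<open>Dirichlet basis function N^p_{i,0} (the sum over m is locally finite).\<close>
definition Ndir :: "nat \<Rightarrow> nat \<Rightarrow> nat \<Rightarrow> real \<Rightarrow> real" where
  "Ndir p n i x =
     (\<Sum>\<^sub>\<infinity>m::int. BD p n (real i + 2 * real_of_int m * real (n + 1)) x
                  - BD p n (- real i + 2 * real_of_int m * real (n + 1)) x)"

definition Xmat :: "nat \<Rightarrow> nat \<Rightarrow> nat \<Rightarrow> nat \<Rightarrow> nat \<Rightarrow> real" where
  "Xmat p r n i j =
     integral {0..1} (\<lambda>x. (deriv ^^ r) (Ndir p n i) x * (deriv ^^ r) (Ndir p n j) x)"

definition alpha :: "nat \<Rightarrow> nat \<Rightarrow> nat \<Rightarrow> real" where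
  "alpha p r k = (if k \<le> p
     then (-1) ^ r * (deriv ^^ (2 * r)) (cardN (2 * p + 1)) (real p + 1 - real k)
     else 0)"

text \<open>Symmetric banded Toeplitz matrix T_n^alpha (entries for 1 \<le> i,j \<le> n).\<close>
definition toeplitz :: "nat \<Rightarrow> (nat \<Rightarrow> real) \<Rightarrow> nat \<Rightarrow> nat \<Rightarrow> real" where
  "toeplitz n a i j = a (nat \<bar>int i - int j\<bar>)"

text \<open>Hankel-type matrix H_n^{alpha,2} (entries for 1 \<le> i,j \<le> n).\<close>
definition hankel2 :: "nat \<Rightarrow> (nat \<Rightarrow> real) \<Rightarrow> nat \<Rightarrow> nat \<Rightarrow> real" where
  "hankel2 n a i j = a (i + j) + a (2 * n + 2 - i - j)"

end

theory Submission
  imports Defs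
begin

text \<open>
  Write \<open>N\<^sub>q\<close> for the cardinal B-spline, \<open>\<nabla> f (x) = f (x) - f (x - 1)\<close> and \<open>L = n + 1\<close>. Since
  \<open>N\<^sub>q\<^sub>+\<^sub>1' = \<nabla> N\<^sub>q\<close>, the \<open>r\<close>-th derivative of \<open>N\<^sub>p\<close> is \<open>\<nabla>\<^sup>r N\<^sub>p\<^sub>-\<^sub>r\<close>, and its autocorrelation at \<open>k\<close> is
  \<open>(-1)\<^sup>r \<nabla>\<^sup>2\<^sup>r\<close> applied to that of \<open>N\<^sub>p\<^sub>-\<^sub>r\<close>, up to a shift; by the symmetry of the splines and the convolution identity
  \<open>N\<^sub>q * N\<^sub>s = N\<^sub>q\<^sub>+\<^sub>s\<^sub>+\<^sub>1\<close> this is the coefficient \<open>\<alpha>\<^sub>k\<close>.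

  Near \<open>[0, 1]\<close> the \<open>i\<close>-th Dirichlet basis function consists of only three spline bumps, centred in the
  variable \<open>y = L x\<close> at \<open>i\<close>, \<open>-i\<close> and \<open>2 L - i\<close>. The reflections \<open>y \<mapsto> -y\<close> and \<open>y \<mapsto> 2 L - y\<close> unfold the
  products of these bumps integrated over \<open>[0, L]\<close> into autocorrelations over the whole line, at the
  distances \<open>i - j\<close> (Toeplitz part), \<open>i + j\<close> and \<open>2 L - i - j\<close> (Hankel part).
\<close>

section \<open>Derivatives of cardinal B-splines\<close>

definition backdiff :: "(real \<Rightarrow> real) \<Rightarrow> real \<Rightarrow> real" where
  "backdiff f x = f x - f (x - 1)"

lemma cardN_nonzeroD: "cardN p t \<noteq> 0 \<Longrightarrow> 0 \<le> t \<and> t < real p + 1"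
proof (induction p arbitrary: t)
  case 0
  then show ?case by (simp split: if_splits)
next
  case (Suc p)
  then have "cardN p t \<noteq> 0 \<or> cardN p (t - 1) \<noteq> 0" by auto
  then show ?case using Suc.IH[of t] Suc.IH[of "t - 1"] by auto
qed

lemma cardN_eq_0: "t < 0 \<or> real p + 1 \<le> t \<Longrightarrow> cardN p t = 0"
  using cardN_nonzeroD[of p t] by force

text \<open>Reflection exchanges the two terms of the recursion. Integers are excluded because
  \<open>cardN 0\<close> is the indicator of a half-open interval.\<close>

lemma cardN_symmetric: "t \<notin> \<int> \<Longrightarrow> cardN p (real p + 1 - t) = cardN p t"
proof (induction p arbitrary: t)
  case 0
  then have "t \<noteq> 0" "t \<noteq> 1" by auto
  then show ?case by auto
next
  case (Suc p)
  have "t - 1 \<notin> \<int>" using Suc.prems by (metis Ints_1 Ints_add diff_add_cancel)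
  then have "cardN p (real p + 1 - (t - 1)) = cardN p (t - 1)"
      "cardN p (real p + 1 - t) = cardN p t"
    using Suc.IH Suc.prems by blast+
  moreover have "real p + 1 - (t - 1) = real (Suc p) + 1 - t"
      "real (Suc p) + 1 - t - 1 = real p + 1 - t" by simp_all
  ultimately show ?case by (simp only: cardN.simps) simp
qed

text \<open>The induction for the derivative rule starts at degree 2, the first degree
  differentiable everywhere. Degrees 1 and 2 are handled directly through truncated powers.\<close>

lemma cardN_1_truncated_powers:
  "cardN (Suc 0) t = max 0 t - 2 * max 0 (t - 1) + max 0 (t - 2)"
  by (auto simp: max_def)

lemma cardN_2_truncated_powers:
  "cardN (Suc (Suc 0)) t =
     ((max 0 t)\<^sup>2 - 3 * (max 0 (t - 1))\<^sup>2 + 3 * (max 0 (t - 2))\<^sup>2 - (max 0 (t - 3))\<^sup>2) / 2"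
  by (auto simp: max_def field_simps power2_eq_square)

lemma DERIV_max_0:
  "x \<noteq> 0 \<Longrightarrow> ((\<lambda>x::real. max 0 x) has_real_derivative (if 0 \<le> x then 1 else 0)) (at x)"
proof (cases "x > 0")
  case True
  then show ?thesis
    by (auto intro!: has_field_derivative_transform_within_open[OF DERIV_ident, where S="{0<..}"])
next
  case False
  moreover assume "x \<noteq> 0"
  ultimately show ?thesis
    by (auto intro!: has_field_derivative_transform_within_open[OF DERIV_const, where S="{..<0}"])
qed

lemma DERIV_max_0_power2:
  "((\<lambda>x::real. (max 0 x)\<^sup>2) has_real_derivative 2 * max 0 x) (at x)"
proof (cases "x = 0")
  case True
  have "((\<lambda>h::real. (max 0 h)\<^sup>2 / h) \<longlongrightarrow> 0) (at 0)"
  proof (rule Lim_transform_eventually)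
    have "((\<lambda>h::real. max 0 h) \<longlongrightarrow> max 0 0) (at 0)"
      by (intro tendsto_intros)
    then show "((\<lambda>h::real. max 0 h) \<longlongrightarrow> 0) (at 0)" by simp
    show "\<forall>\<^sub>F h in at (0::real). max 0 h = (max 0 h)\<^sup>2 / h"
      by (auto simp: eventually_at_filter max_def power2_eq_square)
  qed
  then show ?thesis using True by (simp add: DERIV_def)
next
  case False
  show ?thesis
    by (rule derivative_eq_intros DERIV_max_0 False refl)+ (use False in auto)
qed

lemma DERIV_cardN_1:
  assumes "t \<notin> \<int>"
  shows "(cardN (Suc 0) has_real_derivative backdiff (cardN 0) t) (at t)"
proof -
  have "t \<noteq> 0" "t - 1 \<noteq> 0" "t - 2 \<noteq> 0" using assms by auto
  note d = this[THEN DERIV_max_0]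
  have "((\<lambda>t. max 0 t - 2 * max 0 (t - 1) + max 0 (t - 2)) has_real_derivative
     (if 0 \<le> t then 1 else 0) - 2 * ((if 0 \<le> t - 1 then 1 else 0) * (1 - 0))
      + (if 0 \<le> t - 2 then 1 else 0) * (1 - 0)) (at t)"
    by (intro DERIV_add DERIV_diff DERIV_cmult d DERIV_chain2[of "max 0"] DERIV_ident DERIV_const)
  also have "(\<lambda>t. max 0 t - 2 * max 0 (t - 1) + max 0 (t - 2)) = cardN (Suc 0)"
    using cardN_1_truncated_powers by auto
  finally show ?thesis
    by (rule DERIV_cong) (auto simp: backdiff_def)
qed

lemma DERIV_cardN_2:
  "(cardN (Suc (Suc 0)) has_real_derivative backdiff (cardN (Suc 0)) t) (at t)"
proof -
  have "((\<lambda>t. ((max 0 t)\<^sup>2 - 3 * (max 0 (t - 1))\<^sup>2 + 3 * (max 0 (t - 2))\<^sup>2 - (max 0 (t - 3))\<^sup>2) / 2)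
     has_real_derivative
     (2 * max 0 t - 3 * (2 * max 0 (t - 1) * (1 - 0)) + 3 * (2 * max 0 (t - 2) * (1 - 0))
       - 2 * max 0 (t - 3) * (1 - 0)) / 2) (at t)"
    by (intro DERIV_add DERIV_diff DERIV_cmult DERIV_cdivide DERIV_max_0_power2
          DERIV_chain2[of "\<lambda>x. (max 0 x)\<^sup>2"] DERIV_ident DERIV_const)
  also have "(\<lambda>t. ((max 0 t)\<^sup>2 - 3 * (max 0 (t - 1))\<^sup>2 + 3 * (max 0 (t - 2))\<^sup>2 - (max 0 (t - 3))\<^sup>2) / 2)
      = cardN (Suc (Suc 0))"
    using cardN_2_truncated_powers by auto
  finally show ?thesis
    by (rule DERIV_cong)
       (simp add: backdiff_def cardN_1_truncated_powers diff_diff_eq field_simps del: cardN.simps)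
qed

lemma DERIV_cardN_Suc_Suc:
  "(cardN (Suc (Suc q)) has_real_derivative backdiff (cardN (Suc q)) t) (at t)"
proof (induction q arbitrary: t)
  case 0
  then show ?case by (rule DERIV_cardN_2)
next
  case (Suc q)
  \<comment> \<open>With \<open>d\<close> the degree in the induction hypothesis, both sides are
    expanded in the three values \<open>a\<close>, \<open>b\<close>, \<open>c\<close> of degree
    \<open>d - 1\<close>, which leaves a rational identity in \<open>t\<close> and
    \<open>d\<close>.\<close>
  define a b c d :: real where "a = cardN (Suc q) t" and "b = cardN (Suc q) (t - 1)"
    and "c = cardN (Suc q) (t - 2)" and "d = real q + 2"
  have d0: "d > 0" by (simp add: d_def)
  have N: "cardN (Suc (Suc q)) t = t / d * a + (d + 1 - t) / d * b"
    "cardN (Suc (Suc q)) (t - 1) = (t - 1) / d * b + (d + 2 - t) / d * c"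
    by (simp_all add: a_def b_def c_def d_def add.commute)
  have "((\<lambda>t. t / (d + 1) * cardN (Suc (Suc q)) t + (d + 2 - t) / (d + 1) * cardN (Suc (Suc q)) (t - 1))
    has_real_derivative
      (1 / (d + 1) * cardN (Suc (Suc q)) t + (a - b) * (t / (d + 1)))
      + ((0 - 1) / (d + 1) * cardN (Suc (Suc q)) (t - 1)
         + (b - c) * (1 - 0) * ((d + 2 - t) / (d + 1)))) (at t)"
  proof (intro DERIV_add DERIV_mult DERIV_cdivide DERIV_diff DERIV_ident DERIV_const
      DERIV_chain2[of "cardN (Suc (Suc q))"])
    show "(cardN (Suc (Suc q)) has_real_derivative a - b) (at t)"
      "(cardN (Suc (Suc q)) has_real_derivative b - c) (at (t - 1))"
      using Suc.IH[of t] Suc.IH[of "t - 1"]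
      by (simp_all add: a_def b_def c_def backdiff_def del: cardN.simps)
  qed
  also have "(\<lambda>t. t / (d + 1) * cardN (Suc (Suc q)) t + (d + 2 - t) / (d + 1) * cardN (Suc (Suc q)) (t - 1))
     = cardN (Suc (Suc (Suc q)))"
    by (rule ext) (simp add: d_def add.commute)
  finally show ?case
  proof (rule DERIV_cong)
    show "(1 / (d + 1) * cardN (Suc (Suc q)) t + (a - b) * (t / (d + 1)))
      + ((0 - 1) / (d + 1) * cardN (Suc (Suc q)) (t - 1)
         + (b - c) * (1 - 0) * ((d + 2 - t) / (d + 1))) = backdiff (cardN (Suc (Suc q))) t"
      using d0 unfolding backdiff_def N by (simp add: divide_simps) (simp add: algebra_simps)
  qed
qed

lemma DERIV_cardN_Suc:
  "q \<noteq> 0 \<or> t \<notin> \<int> \<Longrightarrow> (cardN (Suc q) has_real_derivative backdiff (cardN q) t) (at t)"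
  using DERIV_cardN_1 DERIV_cardN_Suc_Suc by (cases q) auto

lemma continuous_on_cardN_Suc: "continuous_on A (cardN (Suc q))"
proof (cases q)
  case 0
  have "continuous_on A (\<lambda>t::real. max 0 t - 2 * max 0 (t - 1) + max 0 (t - 2))"
    by (intro continuous_intros)
  then show ?thesis using 0 by (simp add: cardN_1_truncated_powers[abs_def] del: cardN.simps)
next
  case (Suc k)
  then show ?thesis
    using DERIV_cardN_Suc_Suc[of k] by (blast intro: DERIV_continuous_on has_field_derivative_at_within)
qed

declare cardN.simps[simp del]


section \<open>Bounded functions of bounded support\<close>

text \<open>One constant bounds both values and support. The class contains the discontinuous spline
  of degree 0, is closed under products, differences, shifts and reflections, and consists of
  integrable functions.\<close>

definition bounded_supp :: "(real \<Rightarrow> real) \<Rightarrow> bool" where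
  "bounded_supp f \<longleftrightarrow> f \<in> borel_measurable borel \<and>
     (\<exists>B. \<forall>x. \<bar>f x\<bar> \<le> B \<and> (f x \<noteq> 0 \<longrightarrow> \<bar>x\<bar> \<le> B))"

lemma bounded_supp_integrable:
  assumes "bounded_supp f"
  shows "integrable lborel f"
proof -
  obtain B where B: "\<And>x. \<bar>f x\<bar> \<le> B" "\<And>x. f x \<noteq> 0 \<Longrightarrow> \<bar>x\<bar> \<le> B"
    and m: "f \<in> borel_measurable borel"
    using assms unfolding bounded_supp_def by blast
  show ?thesis
  proof (rule Bochner_Integration.integrable_bound)
    show "integrable lborel (\<lambda>x. B * indicator {-B..B} x :: real)"
      by (intro integrable_mult_right integrable_real_indicator) (auto simp: emeasure_lborel_Icc_eq)
    show "f \<in> borel_measurable lborel" using m by simp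
    show "AE x in lborel. norm (f x) \<le> norm (B * indicator {-B..B} x :: real)"
    proof (rule AE_I2)
      fix x
      show "norm (f x) \<le> norm (B * indicator {-B..B} x :: real)"
        using B(1)[of x] B(2)[of x] by (cases "f x = 0") (auto simp: indicator_def abs_le_iff)
    qed
  qed
qed

text \<open>The factor may be unbounded, like the linear ones in the spline recursion; compactness
  bounds it on the support of \<open>f\<close>.\<close>

lemma bounded_supp_continuous_mult:
  assumes f: "bounded_supp f" and h: "continuous_on UNIV h"
  shows "bounded_supp (\<lambda>x. h x * f x)"
proof -
  obtain B where B: "\<And>x. \<bar>f x\<bar> \<le> B" "\<And>x. f x \<noteq> 0 \<Longrightarrow> \<bar>x\<bar> \<le> B"
    and m: "f \<in> borel_measurable borel"
    using f unfolding bounded_supp_def by blast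
  have "compact (h ` {-B..B})"
    using h by (intro compact_continuous_image) (auto intro: continuous_on_subset)
  then have "bounded (h ` {-B..B})" by (rule compact_imp_bounded)
  then obtain C where C: "\<And>x. x \<in> {-B..B} \<Longrightarrow> \<bar>h x\<bar> \<le> C"
    unfolding bounded_iff by fastforce
  have *: "\<bar>h x * f x\<bar> \<le> \<bar>C\<bar> * B" for x
  proof (cases "f x = 0")
    case True
    then show ?thesis using B(1)[of x] by simp
  next
    case False
    then have "\<bar>h x\<bar> \<le> \<bar>C\<bar>" using B(2)[of x] C[of x] by (auto simp: abs_le_iff)
    then show ?thesis using B(1)[of x] by (simp add: abs_mult mult_mono)
  qed
  have "h \<in> borel_measurable borel" using h by (rule borel_measurable_continuous_onI)
  then have "(\<lambda>x. h x * f x) \<in> borel_measurable borel" using m by measurable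
  moreover have "\<bar>h x * f x\<bar> \<le> max B (\<bar>C\<bar> * B) \<and> (h x * f x \<noteq> 0 \<longrightarrow> \<bar>x\<bar> \<le> max B (\<bar>C\<bar> * B))" for x
    using *[of x] B(2)[of x] by auto
  ultimately show ?thesis unfolding bounded_supp_def by blast
qed

lemma bounded_supp_mult:
  assumes "bounded_supp f" "bounded_supp g"
  shows "bounded_supp (\<lambda>x. f x * g x)"
proof -
  obtain B C where B: "\<And>x. \<bar>f x\<bar> \<le> B" "\<And>x. f x \<noteq> 0 \<Longrightarrow> \<bar>x\<bar> \<le> B"
    and C: "\<And>x. \<bar>g x\<bar> \<le> C"
    and m: "f \<in> borel_measurable borel" "g \<in> borel_measurable borel"
    using assms unfolding bounded_supp_def by blast
  have "\<bar>f x * g x\<bar> \<le> B * C" for x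
    using B(1)[of x] C[of x] by (simp add: abs_mult mult_mono)
  then have "\<bar>f x * g x\<bar> \<le> max B (B * C) \<and> (f x * g x \<noteq> 0 \<longrightarrow> \<bar>x\<bar> \<le> max B (B * C))" for x
    using B(2)[of x] by (auto simp: le_max_iff_disj)
  moreover have "(\<lambda>x. f x * g x) \<in> borel_measurable borel" using m by measurable
  ultimately show ?thesis unfolding bounded_supp_def by blast
qed

lemma bounded_supp_add:
  assumes "bounded_supp f" "bounded_supp g"
  shows "bounded_supp (\<lambda>x. f x + g x)"
proof -
  obtain B C where B: "\<And>x. \<bar>f x\<bar> \<le> B" "\<And>x. f x \<noteq> 0 \<Longrightarrow> \<bar>x\<bar> \<le> B"
    and C: "\<And>x. \<bar>g x\<bar> \<le> C" "\<And>x. g x \<noteq> 0 \<Longrightarrow> \<bar>x\<bar> \<le> C"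
    and m: "f \<in> borel_measurable borel" "g \<in> borel_measurable borel"
    using assms unfolding bounded_supp_def by blast
  have "\<bar>f x + g x\<bar> \<le> B + C \<and> (f x + g x \<noteq> 0 \<longrightarrow> \<bar>x\<bar> \<le> B + C)" for x
    using B[of x] C[of x] by (cases "f x = 0") auto
  moreover have "(\<lambda>x. f x + g x) \<in> borel_measurable borel" using m by measurable
  ultimately show ?thesis unfolding bounded_supp_def by blast
qed

lemma bounded_supp_diff:
  assumes "bounded_supp f" "bounded_supp g"
  shows "bounded_supp (\<lambda>x. f x - g x)"
  using bounded_supp_add[OF assms(1) bounded_supp_continuous_mult[OF assms(2), of "\<lambda>_. -1"]]
  by simp

lemma bounded_supp_shift:
  assumes "bounded_supp f"
  shows "bounded_supp (\<lambda>x. f (x - a))"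
proof -
  obtain B where B: "\<And>x. \<bar>f x\<bar> \<le> B" "\<And>x. f x \<noteq> 0 \<Longrightarrow> \<bar>x\<bar> \<le> B"
    and m: "f \<in> borel_measurable borel"
    using assms unfolding bounded_supp_def by blast
  have "\<bar>f (x - a)\<bar> \<le> B + \<bar>a\<bar> \<and> (f (x - a) \<noteq> 0 \<longrightarrow> \<bar>x\<bar> \<le> B + \<bar>a\<bar>)" for x
    using B(1)[of "x - a"] B(2)[of "x - a"] by (auto simp: abs_le_iff)
  moreover have "(\<lambda>x. f (x - a)) \<in> borel_measurable borel" using m by measurable
  ultimately show ?thesis unfolding bounded_supp_def by blast
qed

lemma bounded_supp_reflect:
  assumes "bounded_supp f"
  shows "bounded_supp (\<lambda>x. f (a - x))"
proof -
  obtain B where B: "\<And>x. \<bar>f x\<bar> \<le> B" "\<And>x. f x \<noteq> 0 \<Longrightarrow> \<bar>x\<bar> \<le> B"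
    and m: "f \<in> borel_measurable borel"
    using assms unfolding bounded_supp_def by blast
  have "\<bar>f (a - x)\<bar> \<le> B + \<bar>a\<bar> \<and> (f (a - x) \<noteq> 0 \<longrightarrow> \<bar>x\<bar> \<le> B + \<bar>a\<bar>)" for x
    using B(1)[of "a - x"] B(2)[of "a - x"] by (auto simp: abs_le_iff)
  moreover have "(\<lambda>x. f (a - x)) \<in> borel_measurable borel" using m by measurable
  ultimately show ?thesis unfolding bounded_supp_def by blast
qed

lemma bounded_supp_indicator_Icc: "bounded_supp (indicator {a..b})"
  unfolding bounded_supp_def
  by (auto intro!: exI[of _ "\<bar>a\<bar> + \<bar>b\<bar> + 1"] simp: indicator_def)

lemma bounded_supp_backdiff_funpow:
  "bounded_supp f \<Longrightarrow> bounded_supp ((backdiff ^^ r) f)"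
  by (induction r) (simp_all add: backdiff_def[abs_def] bounded_supp_diff bounded_supp_shift)

lemma bounded_supp_cardN: "bounded_supp (cardN p)"
proof (induction p)
  case 0
  have "(\<lambda>t::real. if 0 \<le> t \<and> t < 1 then 1 else 0 :: real) \<in> borel_measurable borel"
    by measurable
  moreover have "(\<lambda>t::real. if 0 \<le> t \<and> t < 1 then 1 else 0 :: real) = cardN 0" by (auto simp: cardN.simps)
  ultimately show ?case unfolding bounded_supp_def by (auto intro!: exI[of _ 1] simp: cardN.simps)
next
  case (Suc p)
  show ?case
    unfolding cardN.simps
    by (intro bounded_supp_add bounded_supp_continuous_mult bounded_supp_shift Suc continuous_intros) auto
qed

lemmas bounded_supp_intros =
  bounded_supp_cardN bounded_supp_mult bounded_supp_diff bounded_supp_shift bounded_supp_reflect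
  bounded_supp_backdiff_funpow bounded_supp_indicator_Icc

section \<open>Integrals over the real line and countable exceptional sets\<close>

lemma integral_lborel_shift: "(\<integral>x. f (x - a) \<partial>lborel) = (\<integral>x. f x \<partial>lborel)"
  for f :: "real \<Rightarrow> real"
  using lborel_integral_real_affine[of 1 f "-a"] by simp

lemma integral_lborel_reflect: "(\<integral>x. f (a - x) \<partial>lborel) = (\<integral>x. f x \<partial>lborel)"
  for f :: "real \<Rightarrow> real"
  using lborel_integral_real_affine[of "-1" f a] by simp

text \<open>Carries gauge integrals supplied by the fundamental theorem of calculus over to Lebesgue
  integrals.\<close>

lemma has_integral_Icc_lborel:
  fixes f :: "real \<Rightarrow> real"
  assumes "(f has_integral I) {a..b}" "bounded_supp (\<lambda>x. indicator {a..b} x * f x)"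
  shows "(\<integral>x. indicator {a..b} x * f x \<partial>lborel) = I"
proof -
  have "set_integrable lborel {a..b} f"
    using bounded_supp_integrable[OF assms(2)] by (simp add: set_integrable_def)
  from set_borel_integral_eq_integral(2)[OF this] show ?thesis
    using assms(1) by (simp add: set_lebesgue_integral_def integral_unique)
qed

lemma finite_Ints_Icc: "finite {x \<in> \<int>. a \<le> x \<and> x \<le> (b::real)}"
  using finite_int_segment[of a b] by (simp add: conj_commute)

lemma AE_notin_Ints_shift: "AE x in lborel. (x::real) + a \<notin> \<int>"
proof -
  have "countable ((\<lambda>x::real. x - a) ` \<int>)" by (intro countable_image countable_int)
  from AE_not_in[OF countable_imp_null_set_lborel[OF this]]
  show ?thesis
    by eventually_elim (metis add_diff_cancel image_eqI)
qed

section \<open>Convolution and autocorrelation\<close>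

definition spline_conv :: "nat \<Rightarrow> nat \<Rightarrow> real \<Rightarrow> real" where
  "spline_conv q s k = (\<integral>t. cardN q t * cardN s (k - t) \<partial>lborel)"

text \<open>The factor \<open>cardN 0 (k - t)\<close> cuts out the window
  \<open>k - 1 < t \<le> k\<close>. Integrating the derivative \<open>backdiff (cardN q)\<close>
  from the left of the support up to \<open>k\<close> telescopes to the integral of
  \<open>cardN q\<close> over that window.\<close>

lemma spline_conv_0: "spline_conv q 0 k = cardN (Suc q) k"
proof -
  \<comment> \<open>Left of both \<open>k\<close> and the support, so the lower boundary term is
    zero.\<close>
  define c where "c = min 0 k - 1"
  have c: "c < 0" "c < k" by (auto simp: c_def)
  have "(backdiff (cardN q) has_integral cardN (Suc q) k - cardN (Suc q) c) {c..k}"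
    by (rule fundamental_theorem_of_calculus_strong[OF finite_Ints_Icc[of c k]])
       (use c in \<open>auto intro!: DERIV_cardN_Suc continuous_on_cardN_Suc
          simp: has_real_derivative_iff_has_vector_derivative[symmetric]\<close>)
  moreover have "cardN (Suc q) c = 0" using cardN_nonzeroD[of "Suc q" c] c by auto
  ultimately have "cardN (Suc q) k = (\<integral>t. indicator {c..k} t * backdiff (cardN q) t \<partial>lborel)"
    by (subst has_integral_Icc_lborel)
       (auto intro!: bounded_supp_intros simp: backdiff_def[abs_def])
  also have "\<dots> = (\<integral>t. indicator {c..k} t * cardN q t - indicator {c..k} t * cardN q (t - 1) \<partial>lborel)"
    by (simp add: backdiff_def algebra_simps)
  also have "\<dots> = (\<integral>t. indicator {c..k} t * cardN q t \<partial>lborel)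
      - (\<integral>t. indicator {c..k} t * cardN q (t - 1) \<partial>lborel)"
    by (intro Bochner_Integration.integral_diff bounded_supp_integrable bounded_supp_intros)
  also have "(\<integral>t. indicator {c..k} t * cardN q (t - 1) \<partial>lborel)
      = (\<integral>t. indicator {c - 1..k - 1} (t - 1) * cardN q (t - 1) \<partial>lborel)"
    by (simp add: indicator_def)
  also have "\<dots> = (\<integral>t. indicator {c - 1..k - 1} t * cardN q t \<partial>lborel)"
    by (rule integral_lborel_shift)
  also have "(\<integral>t. indicator {c..k} t * cardN q t \<partial>lborel) - \<dots>
      = (\<integral>t. indicator {c..k} t * cardN q t - indicator {c - 1..k - 1} t * cardN q t \<partial>lborel)"
    by (intro Bochner_Integration.integral_diff[symmetric] bounded_supp_integrable bounded_supp_intros)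
  \<comment> \<open>On the support both lower endpoints are inactive since \<open>c < 0\<close>, so
    there the two indicators differ exactly on the half-open window.\<close>
  also have "\<dots> = spline_conv q 0 k"
    unfolding spline_conv_def
  proof (rule Bochner_Integration.integral_cong[OF refl])
    fix t
    show "indicator {c..k} t * cardN q t - indicator {c - 1..k - 1} t * cardN q t
        = cardN q t * cardN 0 (k - t)"
      using cardN_nonzeroD[of q t] c by (cases "cardN q t = 0") (auto simp: indicator_def cardN.simps)
  qed
  finally show ?thesis by simp
qed

text \<open>Integration by parts: the product of \<open>cardN (Suc q) t\<close> and
  \<open>cardN (Suc s) (k - t)\<close> vanishes at the ends of an interval covering its support, so
  its derivative integrates to zero; the two terms of that derivative give the two sides.\<close>

lemma spline_conv_Suc_right_minus_shift:
  "spline_conv q (Suc s) k - spline_conv q (Suc s) (k - 1)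
     = spline_conv (Suc q) s k - spline_conv (Suc q) s (k - 1)"
proof -
  define b where "b = real q + 3"
  let ?w = "\<lambda>t. backdiff (cardN q) t * cardN (Suc s) (k - t)
               - backdiff (cardN s) (k - t) * cardN (Suc q) t"
  \<comment> \<open>The possible kinks of the two factors on the interval: integers \<open>t\<close>
    and points with \<open>k - t\<close> an integer.\<close>
  let ?S = "{x \<in> \<int>. -1 \<le> x \<and> x \<le> b} \<union> (\<lambda>x. k - x) ` {x \<in> \<int>. k - b \<le> x \<and> x \<le> k + 1}"
  have "(?w has_integral cardN (Suc q) b * cardN (Suc s) (k - b)
      - cardN (Suc q) (-1) * cardN (Suc s) (k - (-1))) {-1..b}"
  proof (rule fundamental_theorem_of_calculus_strong[of ?S])
    show "finite ?S" by (intro finite_UnI finite_imageI finite_Ints_Icc)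
    show "-1 \<le> b" by (simp add: b_def)
    show "continuous_on {-1..b} (\<lambda>t. cardN (Suc q) t * cardN (Suc s) (k - t))"
      by (intro continuous_intros continuous_on_cardN_Suc
            continuous_on_compose2[OF continuous_on_cardN_Suc[of UNIV]]) auto
    fix t assume t: "t \<in> {-1..b} - ?S"
    have 1: "t \<notin> \<int>" using t by auto
    have 2: "k - t \<notin> \<int>"
    proof
      assume "k - t \<in> \<int>"
      then have "t \<in> (\<lambda>x. k - x) ` {x \<in> \<int>. k - b \<le> x \<and> x \<le> k + 1}"
        using t by (intro image_eqI[of _ _ "k - t"]) auto
      then show False using t by blast
    qed
    have "((\<lambda>t. cardN (Suc q) t * cardN (Suc s) (k - t)) has_real_derivative
        backdiff (cardN q) t * cardN (Suc s) (k - t)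
        + backdiff (cardN s) (k - t) * (0 - 1) * cardN (Suc q) t) (at t)"
      by (intro DERIV_mult DERIV_chain2[of "cardN (Suc s)"] DERIV_diff DERIV_const DERIV_ident
            DERIV_cardN_Suc disjI2 1 2)
    then show "((\<lambda>t. cardN (Suc q) t * cardN (Suc s) (k - t)) has_vector_derivative ?w t) (at t)"
      by (simp add: has_real_derivative_iff_has_vector_derivative[symmetric] algebra_simps)
  qed
  moreover have "cardN (Suc q) b = 0" "cardN (Suc q) (-1) = 0"
    using cardN_nonzeroD[of "Suc q" b] cardN_nonzeroD[of "Suc q" "-1"] by (auto simp: b_def)
  ultimately have "(?w has_integral 0) {-1..b}" by (simp)
  then have "(\<integral>t. indicator {-1..b} t * ?w t \<partial>lborel) = 0"
    by (rule has_integral_Icc_lborel)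
       (unfold backdiff_def, intro bounded_supp_intros bounded_supp_shift[of "\<lambda>t. cardN s (k - t)"])
  moreover have "indicator {-1..b} t * ?w t = ?w t" for t
    by (cases "t \<in> {-1..b}")
       (auto simp: b_def backdiff_def cardN_eq_0 not_le)
  ultimately have "0 = (\<integral>t. ?w t \<partial>lborel)" by (simp only:)
  also have "\<dots> = (\<integral>t. (cardN q t * cardN (Suc s) (k - t) - cardN q (t - 1) * cardN (Suc s) (k - 1 - (t - 1)))
        - (cardN (Suc q) t * cardN s (k - t) - cardN (Suc q) t * cardN s (k - 1 - t)) \<partial>lborel)"
    by (simp add: backdiff_def algebra_simps)
  also have "\<dots> = ((\<integral>t. cardN q t * cardN (Suc s) (k - t) \<partial>lborel)
        - (\<integral>t. cardN q (t - 1) * cardN (Suc s) (k - 1 - (t - 1)) \<partial>lborel))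
      - ((\<integral>t. cardN (Suc q) t * cardN s (k - t) \<partial>lborel)
        - (\<integral>t. cardN (Suc q) t * cardN s (k - 1 - t) \<partial>lborel))"
    by (subst Bochner_Integration.integral_diff,
        (intro Bochner_Integration.integrable_diff bounded_supp_integrable bounded_supp_intros
          bounded_supp_shift[of "\<lambda>t. cardN _ (_ - t)"])+)+ simp
  also have "(\<integral>t. cardN q (t - 1) * cardN (Suc s) (k - 1 - (t - 1)) \<partial>lborel) = spline_conv q (Suc s) (k - 1)"
    unfolding spline_conv_def by (rule integral_lborel_shift)
  finally show ?thesis unfolding spline_conv_def by simp
qed

lemma spline_conv_neg: "k < 0 \<Longrightarrow> spline_conv q s k = 0"
proof -
  assume "k < 0"
  then have "cardN q t * cardN s (k - t) = 0" for t
    by (cases "t < 0") (simp_all add: cardN_eq_0)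
  then show ?thesis unfolding spline_conv_def by (simp only: Bochner_Integration.integral_zero)
qed

text \<open>By the previous difference identity (an integration by parts) the defect of the next equation is
  1-periodic in \<open>k\<close>, and it vanishes for \<open>k < 0\<close>.\<close>

lemma spline_conv_Suc: "spline_conv q (Suc s) k = spline_conv (Suc q) s k"
proof -
  define e where "e k = spline_conv q (Suc s) k - spline_conv (Suc q) s k" for k
  have step: "e k = e (k - 1)" for k
    using spline_conv_Suc_right_minus_shift[of q s k] by (simp add: e_def)
  have "e k = e (k - real m)" for m
  proof (induction m)
    case (Suc m)
    then show ?case using step[of "k - real m"] by (simp add: algebra_simps)
  qed simp
  moreover obtain m :: nat where "k < real m" using reals_Archimedean2 by blast
  ultimately have "e k = 0" using spline_conv_neg[of "k - real m"]
    by (metis diff_less_0_iff_less diff_zero e_def)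
  then show ?thesis by (simp add: e_def)
qed

text \<open>Degree is moved from the right factor to the left one until the right factor is
  \<open>cardN 0\<close>.\<close>

lemma spline_conv_eq_cardN: "spline_conv q s k = cardN (Suc (q + s)) k"
proof (induction s arbitrary: q)
  case 0
  then show ?case by (simp add: spline_conv_0)
next
  case (Suc s)
  then show ?case by (simp add: spline_conv_Suc)
qed

section \<open>Autocorrelation of splines and of their differences\<close>

definition autocorr :: "(real \<Rightarrow> real) \<Rightarrow> real \<Rightarrow> real" where
  "autocorr f k = (\<integral>t. f t * f (t - k) \<partial>lborel)"

lemma autocorr_minus: "autocorr f (- k) = autocorr f k"
proof -
  have "autocorr f (- k) = (\<integral>t. f (t - k) * f ((t - k) - (- k)) \<partial>lborel)"
    unfolding autocorr_def by (rule integral_lborel_shift[symmetric])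
  then show ?thesis by (simp add: autocorr_def mult.commute)
qed

lemma autocorr_shift: "(\<integral>t. f (t - a) * f (t - b) \<partial>lborel) = autocorr f (b - a)"
proof -
  have "(\<integral>t. f (t - a) * f ((t - a) - (b - a)) \<partial>lborel) = autocorr f (b - a)"
    unfolding autocorr_def by (rule integral_lborel_shift)
  then show ?thesis by simp
qed

text \<open>Expanding gives four products, each determined by the distance of its shifts. The result
  is minus the central second difference, which is the source of the sign
  \<open>(-1) ^ r\<close>.\<close>

lemma autocorr_backdiff:
  assumes f: "bounded_supp f"
  shows "autocorr (backdiff f) k = 2 * autocorr f k - autocorr f (k + 1) - autocorr f (k - 1)"
proof -
  have H: "has_bochner_integral lborel (\<lambda>t. f (t - a) * f (t - b)) (autocorr f (b - a))" for a b
    unfolding autocorr_shift[symmetric]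
    by (intro has_bochner_integral_integrable bounded_supp_integrable bounded_supp_mult
        bounded_supp_shift f)
  have "has_bochner_integral lborel (\<lambda>t. f (t - 0) * f (t - k) - f (t - 0) * f (t - (k + 1))
      - (f (t - 1) * f (t - k) - f (t - 1) * f (t - (k + 1))))
     (autocorr f (k - 0) - autocorr f (k + 1 - 0) - (autocorr f (k - 1) - autocorr f (k + 1 - 1)))"
    by (intro has_bochner_integral_diff H)
  moreover have "(\<lambda>t. f (t - 0) * f (t - k) - f (t - 0) * f (t - (k + 1))
      - (f (t - 1) * f (t - k) - f (t - 1) * f (t - (k + 1))))
     = (\<lambda>t. backdiff f t * backdiff f (t - k))"
    by (simp add: backdiff_def algebra_simps fun_eq_iff)
  ultimately show ?thesis
    unfolding autocorr_def[of "backdiff f"] by (simp add: has_bochner_integral_integral_eq)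
qed

text \<open>Reflecting the second factor turns correlation into convolution; the symmetry is
  available off the integers, hence almost everywhere.\<close>

lemma autocorr_cardN: "autocorr (cardN q) k = cardN (Suc (2 * q)) (real q + 1 + k)"
proof -
  have "autocorr (cardN q) k = spline_conv q q (real q + 1 + k)"
    unfolding autocorr_def spline_conv_def
  proof (rule integral_cong_AE)
    show "AE t in lborel. cardN q t * cardN q (t - k) = cardN q t * cardN q (real q + 1 + k - t)"
      using AE_notin_Ints_shift[of "- k"]
    proof eventually_elim
      case (elim t)
      then have "cardN q (real q + 1 - (t - k)) = cardN q (t - k)"
        by (intro cardN_symmetric) simp
      then show ?case by (simp add: algebra_simps)
    qed
  qed (use bounded_supp_integrable[OF bounded_supp_mult[OF bounded_supp_cardN[of q]
             bounded_supp_shift[OF bounded_supp_cardN[of q]]], of k]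
           bounded_supp_integrable[OF bounded_supp_mult[OF bounded_supp_cardN[of q]
             bounded_supp_reflect[OF bounded_supp_cardN[of q]]], of "real q + 1 + k"]
       in \<open>simp_all add: borel_measurable_integrable\<close>)
  then show ?thesis by (simp add: spline_conv_eq_cardN mult_2)
qed

text \<open>Each difference contributes minus a central second difference. Written with backward
  differences it is evaluated one unit further right, which accounts for the summand
  \<open>real r\<close>.\<close>

lemma autocorr_backdiff_funpow_cardN:
  "autocorr ((backdiff ^^ r) (cardN q)) k
     = (-1) ^ r * (backdiff ^^ (2 * r)) (cardN (Suc (2 * q))) (real q + 1 + real r + k)"
proof (induction r arbitrary: k)
  case 0
  then show ?case by (simp add: autocorr_cardN)
next
  case (Suc r)
  define h where "h = (backdiff ^^ (2 * r)) (cardN (Suc (2 * q)))"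
  define c where "c = real q + 1 + real r"
  have "bounded_supp ((backdiff ^^ r) (cardN q))" by (intro bounded_supp_intros)
  then have "autocorr ((backdiff ^^ Suc r) (cardN q)) k
      = 2 * ((-1) ^ r * h (c + k)) - (-1) ^ r * h (c + (k + 1)) - (-1) ^ r * h (c + (k - 1))"
    by (simp add: autocorr_backdiff Suc.IH h_def c_def)
  also have "\<dots> = (-1) ^ Suc r * backdiff (backdiff h) (c + 1 + k)"
    by (simp only: backdiff_def) (simp add: algebra_simps)
  also have "backdiff (backdiff h) = (backdiff ^^ (2 * Suc r)) (cardN (Suc (2 * q)))"
    by (simp add: h_def)
  finally show ?case by (simp add: c_def add_ac)
qed

section \<open>Support, symmetry and derivatives of iterated differences\<close>

lemma backdiff_funpow_cardN_eq_0:
  "t < 0 \<or> real q + 1 + real r \<le> t \<Longrightarrow> (backdiff ^^ r) (cardN q) t = 0"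
  by (induction r arbitrary: t) (auto simp: backdiff_def cardN_eq_0)

text \<open>Reflection swaps the two terms of each backward difference and so costs one
  sign.\<close>

lemma backdiff_funpow_cardN_symmetric:
  "t \<notin> \<int> \<Longrightarrow>
     (backdiff ^^ r) (cardN q) (real q + 1 + real r - t) = (-1) ^ r * (backdiff ^^ r) (cardN q) t"
proof (induction r arbitrary: t)
  case 0
  then show ?case by (simp add: cardN_symmetric)
next
  case (Suc r)
  have "t - 1 \<notin> \<int>" using Suc.prems by (metis Ints_1 Ints_add diff_add_cancel)
  from Suc.IH[OF this] Suc.IH[OF Suc.prems] show ?case
    by (simp add: backdiff_def algebra_simps)
qed

lemma DERIV_backdiff_funpow_cardN:
  "q \<noteq> 0 \<or> t \<notin> \<int> \<Longrightarrow>
     ((backdiff ^^ r) (cardN (Suc q)) has_real_derivative (backdiff ^^ Suc r) (cardN q) t) (at t)"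
proof (induction r arbitrary: t)
  case 0
  then show ?case by (simp add: DERIV_cardN_Suc)
next
  case (Suc r)
  have "t - 1 \<notin> \<int>" if "t \<notin> \<int>" using that by (metis Ints_1 Ints_add diff_add_cancel)
  with Suc.prems have s: "q \<noteq> 0 \<or> t - 1 \<notin> \<int>" by blast
  have "((\<lambda>t. (backdiff ^^ r) (cardN (Suc q)) t - (backdiff ^^ r) (cardN (Suc q)) (t - 1))
      has_real_derivative
      (backdiff ^^ Suc r) (cardN q) t - (backdiff ^^ Suc r) (cardN q) (t - 1) * (1 - 0)) (at t)"
    by (intro DERIV_diff Suc.IH[OF Suc.prems] Suc.IH[OF s] DERIV_ident DERIV_const
        DERIV_chain2[of "(backdiff ^^ r) (cardN (Suc q))"])
  moreover have "(\<lambda>t. (backdiff ^^ r) (cardN (Suc q)) t - (backdiff ^^ r) (cardN (Suc q)) (t - 1))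
     = (backdiff ^^ Suc r) (cardN (Suc q))"
    by (simp add: backdiff_def fun_eq_iff)
  ultimately show ?case
    by (simp add: backdiff_def[of "backdiff ((backdiff ^^ r) (cardN q))"])
qed

text \<open>Every spline differentiated here has degree at least 2, so the derivative exists at
  every point and the equality of functions can be iterated.\<close>

lemma deriv_funpow_cardN:
  "(deriv ^^ s) (cardN (Suc q + s)) = (backdiff ^^ s) (cardN (Suc q))"
proof (induction s arbitrary: q)
  case (Suc s)
  have "(deriv ^^ s) (cardN (Suc q + Suc s)) = (backdiff ^^ s) (cardN (Suc (Suc q)))"
    using Suc.IH[of "Suc q"] by simp
  then have "(deriv ^^ Suc s) (cardN (Suc q + Suc s)) = deriv ((backdiff ^^ s) (cardN (Suc (Suc q))))"
    by simp
  also have "\<dots> = (backdiff ^^ Suc s) (cardN (Suc q))"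
    using DERIV_backdiff_funpow_cardN[of "Suc q", THEN DERIV_imp_deriv] by blast
  finally show ?case .
qed simp

section \<open>The Dirichlet basis\<close>

text \<open>For \<open>r \<le> p\<close> this is the \<open>r\<close>-th derivative of the centred spline \<open>y \<mapsto> N\<^sub>p (y + (p + 1) / 2)\<close>, made
  right-continuous at the knots when \<open>r = p\<close>.\<close>

definition spline_deriv :: "nat \<Rightarrow> nat \<Rightarrow> real \<Rightarrow> real" where
  "spline_deriv p r y = (backdiff ^^ r) (cardN (p - r)) (y + (real p + 1) / 2)"

lemma spline_deriv_eq_shift:
  "spline_deriv p r = (\<lambda>y. (backdiff ^^ r) (cardN (p - r)) (y - (- ((real p + 1) / 2))))"
  by (rule ext) (simp add: spline_deriv_def)

lemma bounded_supp_spline_deriv: "bounded_supp (spline_deriv p r)"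
  unfolding spline_deriv_eq_shift by (intro bounded_supp_intros)

lemma spline_deriv_eq_0:
  "r \<le> p \<Longrightarrow> (real p + 1) / 2 < \<bar>y\<bar> \<Longrightarrow> spline_deriv p r y = 0"
  unfolding spline_deriv_def
  by (rule backdiff_funpow_cardN_eq_0) (auto simp: of_nat_diff abs_if field_simps split: if_splits)

lemma spline_deriv_minus:
  assumes "r \<le> p" "y + (real p + 1) / 2 \<notin> \<int>"
  shows "spline_deriv p r (- y) = (-1) ^ r * spline_deriv p r y"
proof -
  have "real (p - r) + 1 + real r - (y + (real p + 1) / 2) = - y + (real p + 1) / 2"
    using assms(1) by (simp add: of_nat_diff field_simps)
  then show ?thesis
    using backdiff_funpow_cardN_symmetric[OF assms(2), of r "p - r"] by (simp only: spline_deriv_def)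
qed

lemma DERIV_spline_deriv:
  assumes "Suc r < p \<or> (Suc r = p \<and> y + (real p + 1) / 2 \<notin> \<int>)"
  shows "(spline_deriv p r has_real_derivative spline_deriv p (Suc r) y) (at y)"
proof -
  have p: "p - r = Suc (p - Suc r)" using assms by auto
  have "((\<lambda>y. (backdiff ^^ r) (cardN (Suc (p - Suc r))) (y + (real p + 1) / 2)) has_real_derivative
     (backdiff ^^ Suc r) (cardN (p - Suc r)) (y + (real p + 1) / 2) * (1 + 0)) (at y)"
    by (intro DERIV_chain2[of "(backdiff ^^ r) (cardN (Suc (p - Suc r)))"] DERIV_add DERIV_ident
        DERIV_const DERIV_backdiff_funpow_cardN) (use assms in auto)
  then show ?thesis by (simp add: spline_deriv_def[abs_def] p)
qed

text \<open>The centring cancels in the autocorrelation. Evenness allows the choice of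
  \<open>- real m\<close>, which gives the argument \<open>p + 1 - m\<close> occurring in
  \<open>alpha\<close>.\<close>

lemma autocorr_spline_deriv_eq_alpha:
  assumes "r \<le> p" "\<bar>k\<bar> = real m"
  shows "autocorr (spline_deriv p r) k = alpha p r m"
proof -
  let ?f = "(backdiff ^^ r) (cardN (p - r))"
  let ?s = "(real p + 1) / 2"
  have "autocorr (spline_deriv p r) k = (\<integral>t. ?f (t - (- ?s)) * ?f (t - (k - ?s)) \<partial>lborel)"
    by (simp add: autocorr_def spline_deriv_def algebra_simps)
  also have "\<dots> = autocorr ?f k" unfolding autocorr_shift by simp
  also have "\<dots> = autocorr ?f (- real m)"
    using assms(2) autocorr_minus[of ?f k] by (metis abs_eq_iff abs_of_nat minus_minus)
  also have "\<dots> = (-1) ^ r * (backdiff ^^ (2 * r)) (cardN (Suc (2 * (p - r)))) (real p + 1 - real m)"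
    using assms(1) by (simp add: autocorr_backdiff_funpow_cardN of_nat_diff)
  also have "\<dots> = alpha p r m"
  proof (cases "m \<le> p")
    case True
    have "Suc (2 * (p - r)) + 2 * r = 2 * p + 1" using assms(1) by simp
    then show ?thesis
      using True deriv_funpow_cardN[of "2 * r" "2 * (p - r)"] by (simp add: alpha_def)
  next
    case False
    then have "(backdiff ^^ (2 * r)) (cardN (Suc (2 * (p - r)))) (real p + 1 - real m) = 0"
    proof (cases "m = Suc p")
      case True
      \<comment> \<open>At \<open>m = Suc p\<close> the argument is 0, a boundary point that the
        support lemma does not cover. There the iterated difference equals the spline itself, whose
        degree is at least 1, so it vanishes.\<close>
      have "cardN (Suc q) 0 = 0" for q
        by (induction q) (simp_all add: cardN_1_truncated_powers cardN.simps(2)[of "Suc _"] cardN_eq_0)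
      moreover have "(backdiff ^^ k) f 0 = f 0" if "\<And>t. t < 0 \<Longrightarrow> f t = 0" for k f
      proof -
        have "(\<forall>t<0. (backdiff ^^ k) f t = 0) \<and> (backdiff ^^ k) f 0 = f 0"
          using that by (induction k) (auto simp: backdiff_def)
        then show ?thesis by blast
      qed
      ultimately show ?thesis using True by (simp add: cardN_eq_0)
    qed (auto intro!: backdiff_funpow_cardN_eq_0)
    then show ?thesis using False by (simp add: alpha_def)
  qed
  finally show ?thesis .
qed

section \<open>Unfolding products on the interval by reflection\<close>

definition dirichlet_fold :: "real \<Rightarrow> (real \<Rightarrow> real) \<Rightarrow> real \<Rightarrow> real \<Rightarrow> real" where
  "dirichlet_fold L g a y = g (y - a) - g (y + a) - g (y + a - 2 * L)"

lemma integral_indicator_Icc_combine: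
  assumes "bounded_supp h" "u \<le> v" "v \<le> w"
  shows "(\<integral>y. indicator {u..v} y * h y \<partial>lborel) + (\<integral>y. indicator {v..w} y * h y \<partial>lborel)
    = (\<integral>y. indicator {u..w} y * h y \<partial>lborel)"
proof -
  have i: "integrable lborel (\<lambda>y. indicator {c..d} y * h y)" for c d
    by (intro bounded_supp_integrable bounded_supp_intros assms)
  have "(\<integral>y. indicator {u..v} y * h y \<partial>lborel) + (\<integral>y. indicator {v..w} y * h y \<partial>lborel)
    = (\<integral>y. indicator {u..v} y * h y + indicator {v..w} y * h y \<partial>lborel)"
    by (rule Bochner_Integration.integral_add[symmetric, OF i i])
  also have "\<dots> = (\<integral>y. indicator {u..w} y * h y \<partial>lborel)"
  proof (rule integral_cong_AE)
    show "AE y in lborel. indicator {u..v} y * h y + indicator {v..w} y * h y = indicator {u..w} y * h y"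
      using AE_lborel_singleton[of v] by eventually_elim (use assms in \<open>auto simp: indicator_def\<close>)
  qed (intro borel_measurable_add borel_measurable_integrable[OF i])+
  finally show ?thesis .
qed

text \<open>The nine products on \<open>[0, L]\<close> recombine in pairs and triples to integrals over the whole line,
  because the reflections about \<open>0\<close> and \<open>L\<close> carry them to the adjacent
  intervals \<open>[-L, 0]\<close> and \<open>[L, 2 L]\<close>.\<close>

lemma integral_dirichlet_fold_mult:
  fixes g :: "real \<Rightarrow> real"
  assumes g: "bounded_supp g"
    and supp: "\<And>y. s < \<bar>y\<bar> \<Longrightarrow> g y = 0"
    and sym: "\<And>a. AE y in lborel. g (- (y - a)) = \<epsilon> * g (y - a)"
    and \<epsilon>: "\<epsilon> * \<epsilon> = 1"
    and s: "0 \<le> s" "2 * s < L" and a: "0 < a" "a < L" and b: "0 < b" "b < L"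
  shows "(\<integral>y. indicator {0..L} y * (dirichlet_fold L g a y * dirichlet_fold L g b y) \<partial>lborel)
    = autocorr g (b - a) - autocorr g (- b - a) - autocorr g (2 * L - b - a)"
proof -
  define A where "A u v c d = (\<integral>y. indicator {u..v} y * (g (y - c) * g (y - d)) \<partial>lborel)"
    for u v c d :: real
  have bs: "bounded_supp (\<lambda>y. g (y - c) * g (y - d))" for c d
    by (intro bounded_supp_intros g)
  have i: "integrable lborel (\<lambda>y. indicator {u..v} y * (g (y - c) * g (y - d)))" for u v c d
    by (intro bounded_supp_integrable bounded_supp_intros g)
  have H: "has_bochner_integral lborel (\<lambda>y. indicator {u..v} y * (g (y - c) * g (y - d))) (A u v c d)"
    for u v c d
    unfolding A_def by (rule has_bochner_integral_integrable[OF i])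
  have combine: "A u v c d + A v w c d = A u w c d" if "u \<le> v" "v \<le> w" for u v w c d
    unfolding A_def by (rule integral_indicator_Icc_combine[OF bs that])
  \<comment> \<open>The factor \<open>\<epsilon>\<close> enters once per bump and squares to 1, so
    even and odd derivatives are treated alike.\<close>
  have reflect: "A u v c d = A (e - v) (e - u) (e - c) (e - d)" for u v c d e
  proof -
    have "A u v c d = (\<integral>y. indicator {u..v} (e - y) * (g (e - y - c) * g (e - y - d)) \<partial>lborel)"
      unfolding A_def by (rule integral_lborel_reflect[symmetric])
    also have "\<dots> = A (e - v) (e - u) (e - c) (e - d)"
      unfolding A_def
    proof (rule integral_cong_AE)
      show "AE y in lborel. indicator {u..v} (e - y) * (g (e - y - c) * g (e - y - d))
          = indicator {e - v..e - u} y * (g (y - (e - c)) * g (y - (e - d)))"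
        using sym[of "e - c"] sym[of "e - d"]
      proof eventually_elim
        case (elim y)
        have "g (e - y - c) = \<epsilon> * g (y - (e - c))" "g (e - y - d) = \<epsilon> * g (y - (e - d))"
          using elim by (simp_all add: algebra_simps)
        then have "g (e - y - c) * g (e - y - d) = (\<epsilon> * \<epsilon>) * (g (y - (e - c)) * g (y - (e - d)))"
          by simp
        moreover have "indicator {u..v} (e - y) = (indicator {e - v..e - u} y :: real)"
          by (auto simp: indicator_def)
        ultimately show ?case using \<epsilon> by simp
      qed
      have "bounded_supp (\<lambda>y. indicator {u..v} (e - y) * (g (e - y - c) * g (e - y - d)))"
        using bounded_supp_reflect[OF bounded_supp_mult[OF bounded_supp_indicator_Icc bs]] .
      then show "(\<lambda>y. indicator {u..v} (e - y) * (g (e - y - c) * g (e - y - d))) \<in> borel_measurable lborel"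
        by (simp add: bounded_supp_def)
    qed (rule borel_measurable_integrable[OF i])
    finally show ?thesis .
  qed
  have whole: "A u v c d = autocorr g (d - c)"
    if "\<And>y. y < u \<or> v < y \<Longrightarrow> s < \<bar>y - c\<bar> \<or> s < \<bar>y - d\<bar>" for u v c d
    unfolding A_def autocorr_shift[symmetric]
  proof (rule Bochner_Integration.integral_cong[OF refl])
    fix y
    show "indicator {u..v} y * (g (y - c) * g (y - d)) = g (y - c) * g (y - d)"
      using that[of y] supp[of "y - c"] supp[of "y - d"] by (cases "y \<in> {u..v}") auto
  qed
  have zero: "A 0 L c d = 0" if "\<And>y. 0 \<le> y \<Longrightarrow> y \<le> L \<Longrightarrow> s < \<bar>y - c\<bar> \<or> s < \<bar>y - d\<bar>" for c d
  proof -
    have "indicator {0..L} y * (g (y - c) * g (y - d)) = 0" for y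
      using that[of y] supp[of "y - c"] supp[of "y - d"] by (cases "y \<in> {0..L}") auto
    then show ?thesis unfolding A_def by (simp only: Bochner_Integration.integral_zero)
  qed
  define F where "F c d y = indicator {0..L} y * (g (y - c) * g (y - d))" for c d y
  have "has_bochner_integral lborel
     (\<lambda>y. (F a b y + F (- a) (- b) y + F (2 * L - a) (2 * L - b) y)
        - (F a (- b) y + F (- a) b y) - (F a (2 * L - b) y + F (2 * L - a) b y)
        + (F (- a) (2 * L - b) y + F (2 * L - a) (- b) y))
     ((A 0 L a b + A 0 L (- a) (- b) + A 0 L (2 * L - a) (2 * L - b))
        - (A 0 L a (- b) + A 0 L (- a) b) - (A 0 L a (2 * L - b) + A 0 L (2 * L - a) b)
        + (A 0 L (- a) (2 * L - b) + A 0 L (2 * L - a) (- b)))"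
    unfolding F_def by (intro has_bochner_integral_add has_bochner_integral_diff H)
  moreover have "(\<lambda>y. (F a b y + F (- a) (- b) y + F (2 * L - a) (2 * L - b) y)
        - (F a (- b) y + F (- a) b y) - (F a (2 * L - b) y + F (2 * L - a) b y)
        + (F (- a) (2 * L - b) y + F (2 * L - a) (- b) y))
      = (\<lambda>y. indicator {0..L} y * (dirichlet_fold L g a y * dirichlet_fold L g b y))"
    unfolding F_def dirichlet_fold_def by (rule ext) (simp add: algebra_simps)
  ultimately have "(\<integral>y. indicator {0..L} y * (dirichlet_fold L g a y * dirichlet_fold L g b y) \<partial>lborel)
     = (A 0 L a b + A 0 L (- a) (- b) + A 0 L (2 * L - a) (2 * L - b))
        - (A 0 L a (- b) + A 0 L (- a) b) - (A 0 L a (2 * L - b) + A 0 L (2 * L - a) b)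
        + (A 0 L (- a) (2 * L - b) + A 0 L (2 * L - a) (- b))"
    by (metis (no_types, lifting) has_bochner_integral_integral_eq)
  \<comment> \<open>The centres \<open>- a\<close> and \<open>2 * L - b\<close> are more than
    \<open>L > 2 * s\<close> apart, and so are \<open>2 * L - a\<close> and \<open>- b\<close>; such
    bumps do not overlap.\<close>
  moreover have "A 0 L (- a) (2 * L - b) = 0" "A 0 L (2 * L - a) (- b) = 0"
    by (rule zero; use s a b in linarith)+
  \<comment> \<open>Toeplitz part: the reflections about 0 and \<open>L\<close> turn the second and
    third products into the first one, taken over the two adjacent intervals.\<close>
  moreover have "A 0 L a b + A 0 L (- a) (- b) + A 0 L (2 * L - a) (2 * L - b) = autocorr g (b - a)"
  proof -
    have "A 0 L (- a) (- b) = A (- L) 0 a b" "A 0 L (2 * L - a) (2 * L - b) = A L (2 * L) a b"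
      using reflect[of 0 L "- a" "- b" 0] reflect[of 0 L "2 * L - a" "2 * L - b" "2 * L"] by simp_all
    moreover have "A (- L) 0 a b + A 0 L a b = A (- L) L a b" "A (- L) L a b + A L (2 * L) a b = A (- L) (2 * L) a b"
      using s by (intro combine; linarith)+
    moreover have "A (- L) (2 * L) a b = autocorr g (b - a)"
      by (rule whole) (use s a b in linarith)
    ultimately show ?thesis by linarith
  qed
  \<comment> \<open>Hankel part from the left end, by reflection about 0.\<close>
  moreover have "A 0 L a (- b) + A 0 L (- a) b = autocorr g (- b - a)"
  proof -
    have "A 0 L (- a) b = A (- L) 0 a (- b)"
      using reflect[of 0 L "- a" b 0] by simp
    moreover have "A (- L) 0 a (- b) + A 0 L a (- b) = A (- L) L a (- b)"
      using s by (intro combine; linarith)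
    moreover have "A (- L) L a (- b) = autocorr g (- b - a)"
      by (rule whole) (use s a b in linarith)
    ultimately show ?thesis by linarith
  qed
  \<comment> \<open>Hankel part from the right end, by reflection about \<open>L\<close>.\<close>
  moreover have "A 0 L a (2 * L - b) + A 0 L (2 * L - a) b = autocorr g (2 * L - b - a)"
  proof -
    have "A 0 L (2 * L - a) b = A L (2 * L) a (2 * L - b)"
      using reflect[of 0 L "2 * L - a" b "2 * L"] by simp
    moreover have "A 0 L a (2 * L - b) + A L (2 * L) a (2 * L - b) = A 0 (2 * L) a (2 * L - b)"
      using s by (intro combine; linarith)
    moreover have "A 0 (2 * L) a (2 * L - b) = autocorr g (2 * L - b - a)"
      by (rule whole) (use s a b in linarith)
    ultimately show ?thesis by linarith
  qed
  ultimately show ?thesis by simp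
qed

section \<open>The Dirichlet basis and its derivatives near the unit interval\<close>

lemma Ndir_eq_dirichlet_fold:
  assumes i: "1 \<le> i" "i \<le> n" and n: "p + 1 \<le> n"
    and y: "-1 < real (n + 1) * x" "real (n + 1) * x < real (n + 1) + 1"
  shows "Ndir p n i x = dirichlet_fold (real (n + 1)) (spline_deriv p 0) (real i) (real (n + 1) * x)"
proof -
  define L where "L = real (n + 1)"
  define y where "y = L * x"
  let ?g = "spline_deriv p 0"
  have BD: "BD p n c x = ?g (y - c)" for c
    by (simp add: BD_def spline_deriv_def y_def L_def)
  have z: "?g t = 0" if "L \<le> \<bar>t\<bar>" for t
    using that n by (intro spline_deriv_eq_0) (simp_all add: L_def)
  have y': "-1 < y" "y < L + 1" and i': "1 \<le> real i" "real i + 1 \<le> L"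
    using y i by (simp_all add: y_def L_def)
  have "Ndir p n i x = (\<Sum>\<^sub>\<infinity>m::int. ?g (y - (real i + 2 * real_of_int m * L))
      - ?g (y - (- real i + 2 * real_of_int m * L)))"
    unfolding Ndir_def BD L_def ..
  also have "\<dots> = (\<Sum>\<^sub>\<infinity>m\<in>{0, 1::int}. ?g (y - (real i + 2 * real_of_int m * L))
      - ?g (y - (- real i + 2 * real_of_int m * L)))"
  proof (rule infsum_cong_neutral)
    \<comment> \<open>Since \<open>real i + 1 \<le> L\<close>, the centres for the other
      \<open>m\<close> are at distance at least \<open>L\<close> even on the strip widened by 1, and
      \<open>L\<close> exceeds the half-width \<open>(p + 1) / 2\<close>.\<close>
    fix m :: int assume "m \<in> UNIV - {0, 1}"
    then have "m \<le> -1 \<or> 2 \<le> m" by auto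
    then have "real_of_int m \<le> -1 \<or> 2 \<le> real_of_int m" by linarith
    then have "real_of_int m * L \<le> (-1) * L \<or> 2 * L \<le> real_of_int m * L"
      using i' mult_right_mono[of _ _ L] by fastforce
    then have "L \<le> \<bar>y - (real i + 2 * real_of_int m * L)\<bar>" "L \<le> \<bar>y - (- real i + 2 * real_of_int m * L)\<bar>"
      using y' i' by linarith+
    then show "?g (y - (real i + 2 * real_of_int m * L)) - ?g (y - (- real i + 2 * real_of_int m * L)) = 0"
      using z by simp
  qed auto
  also have "\<dots> = ?g (y - real i) - ?g (y + real i) + (?g (y - (real i + 2 * L)) - ?g (y + real i - 2 * L))"
    by (simp add: algebra_simps)
  \<comment> \<open>Of the four remaining bumps the one centred at \<open>i + 2 * L\<close> is out
    of reach as well, which leaves three.\<close>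
  also have "?g (y - (real i + 2 * L)) = 0"
    using y' i' by (intro z) linarith
  finally show ?thesis by (simp add: dirichlet_fold_def y_def L_def)
qed

text \<open>The chain rule supplies one factor \<open>L\<close>. Integrality of \<open>a\<close> and
  \<open>L\<close> makes all three bumps share the same knots, so a single condition on
  \<open>x\<close> suffices.\<close>

lemma DERIV_dirichlet_fold_spline_deriv:
  assumes "Suc r < p \<or> (Suc r = p \<and> L * x + (real p + 1) / 2 \<notin> \<int>)"
    and "a \<in> \<int>" "L \<in> \<int>"
  shows "((\<lambda>x. L ^ r * dirichlet_fold L (spline_deriv p r) a (L * x)) has_real_derivative
     L ^ Suc r * dirichlet_fold L (spline_deriv p (Suc r)) a (L * x)) (at x)"
proof -
  have D: "((\<lambda>x. spline_deriv p r (L * x + c)) has_real_derivative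
      spline_deriv p (Suc r) (L * x + c) * (L * 1 + 0)) (at x)" if c: "c \<in> \<int>" for c
  proof (intro DERIV_chain2[of "spline_deriv p r"] DERIV_spline_deriv DERIV_add DERIV_cmult
      DERIV_ident DERIV_const)
    have "L * x + c + (real p + 1) / 2 \<notin> \<int>" if "L * x + (real p + 1) / 2 \<notin> \<int>"
    proof
      assume "L * x + c + (real p + 1) / 2 \<in> \<int>"
      then have "L * x + c + (real p + 1) / 2 - c \<in> \<int>" using c by (rule Ints_diff)
      then show False using that by (simp add: algebra_simps)
    qed
    with assms(1) show "Suc r < p \<or> (Suc r = p \<and> L * x + c + (real p + 1) / 2 \<notin> \<int>)" by blast
  qed
  have "((\<lambda>x. L ^ r * (spline_deriv p r (L * x + (- a)) - spline_deriv p r (L * x + a)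
        - spline_deriv p r (L * x + (a - 2 * L)))) has_real_derivative
      L ^ r * (spline_deriv p (Suc r) (L * x + (- a)) * (L * 1 + 0)
        - spline_deriv p (Suc r) (L * x + a) * (L * 1 + 0)
        - spline_deriv p (Suc r) (L * x + (a - 2 * L)) * (L * 1 + 0))) (at x)"
    by (intro DERIV_cmult DERIV_diff D) (use assms in auto)
  then show ?thesis
    by (simp add: dirichlet_fold_def algebra_simps)
qed

text \<open>Differentiating an identity needs it on an open set, hence a strip around the closed
  interval. Below order \<open>p\<close> the formula holds on the entire strip, knots included, so
  knots are excluded for the last derivative only.\<close>

lemma deriv_funpow_Ndir:
  assumes i: "1 \<le> i" "i \<le> n" and n: "p + 1 \<le> n"
    and "r < p \<or> (r = p \<and> real (n + 1) * x + (real p + 1) / 2 \<notin> \<int>)"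
    and "-1 < real (n + 1) * x" "real (n + 1) * x < real (n + 1) + 1" and "p \<noteq> 0"
  shows "(deriv ^^ r) (Ndir p n i) x
     = real (n + 1) ^ r * dirichlet_fold (real (n + 1)) (spline_deriv p r) (real i) (real (n + 1) * x)"
  using assms(4-6)
proof (induction r arbitrary: x)
  case 0
  then show ?case using Ndir_eq_dirichlet_fold[OF i n] by simp
next
  case (Suc r)
  let ?L = "real (n + 1)"
  let ?F = "\<lambda>r x. ?L ^ r * dirichlet_fold ?L (spline_deriv p r) (real i) (?L * x)"
  let ?S = "{x. -1 < ?L * x} \<inter> {x. ?L * x < ?L + 1}"
  have "open ?S" by (intro open_Int open_Collect_less continuous_intros)
  moreover have "x \<in> ?S" using Suc.prems by blast
  moreover have "?F r z = (deriv ^^ r) (Ndir p n i) z" if "z \<in> ?S" for z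
    using that Suc.IH[of z] Suc.prems(1) by auto
  moreover have "(?F r has_real_derivative ?F (Suc r) x) (at x)"
    using Suc.prems by (intro DERIV_dirichlet_fold_spline_deriv) auto
  ultimately have "((deriv ^^ r) (Ndir p n i) has_real_derivative ?F (Suc r) x) (at x)"
    by (blast intro: has_field_derivative_transform_within_open)
  then show ?case by (simp add: DERIV_imp_deriv)
qed

section \<open>Rescaling to integer knot spacing and assembling the matrix entries\<close>

theorem mainTheorem3:
  fixes p n r :: nat
  assumes "p \<ge> 1" and "n \<ge> 1" and "r \<le> p"
    and "n \<ge> max (p + 1) (p + p div 2 - 1)"
  shows "\<forall>i\<in>{1..n}. \<forall>j\<in>{1..n}.
           Xmat p r n i j = real (n + 1) powi (2 * int r - 1)
             * (toeplitz n (alpha p r) i j - hankel2 n (alpha p r) i j)"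
proof (intro ballI)
  fix i j assume "i \<in> {1..n}" "j \<in> {1..n}"
  then have i: "1 \<le> i" "i \<le> n" and j: "1 \<le> j" "j \<le> n" by auto
  have n: "p + 1 \<le> n" using assms(4) by simp
  define L where "L = real (n + 1)"
  define s where "s = (real p + 1) / 2"
  define g where "g = spline_deriv p r"
  define K where "K y = dirichlet_fold L g (real i) y * dirichlet_fold L g (real j) y" for y
  have L: "0 < L" by (simp add: L_def)
  have deriv: "(deriv ^^ r) (Ndir p n k) x = L ^ r * dirichlet_fold L g (real k) (L * x)"
    if "1 \<le> k" "k \<le> n" "x \<in> {0..1} - (\<lambda>z. (z - s) / L) ` \<int>" for k x
  proof -
    have "L * x + s \<notin> \<int>"
    proof
      assume "L * x + s \<in> \<int>"
      then have "x \<in> (\<lambda>z. (z - s) / L) ` \<int>"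
        using L by (intro image_eqI[of _ _ "L * x + s"]) auto
      then show False using that by blast
    qed
    moreover have "0 \<le> L * x" "L * x \<le> L" using that L by (auto simp: mult_left_le)
    then have "-1 < L * x" "L * x < L + 1" by linarith+
    ultimately show ?thesis
      using that assms(1,3) n unfolding L_def g_def s_def
      by (intro deriv_funpow_Ndir) linarith+
  qed
  have bK: "bounded_supp (\<lambda>y. indicator {0..L} y * K y)"
    unfolding K_def dirichlet_fold_def g_def
    by (intro bounded_supp_intros bounded_supp_spline_deriv
        bounded_supp_shift[where a="- _", simplified] bounded_supp_shift[where a="2 * L - _"])
  have ind: "indicator {0..L} (0 + L * x) = (indicator {0..1} x :: real)" for x
    using L by (auto simp: indicator_def mult_le_cancel_left1 zero_le_mult_iff)
  \<comment> \<open>The integrand is replaced off a countable set of knots; each of the two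
    derivatives contributes \<open>L ^ r\<close>.\<close>
  have "Xmat p r n i j = integral {0..1} (\<lambda>x. L ^ (2 * r) * K (L * x))"
    unfolding Xmat_def
  proof (rule integral_spike)
    have "countable ((\<lambda>z. (z - s) / L) ` \<int>)" by (intro countable_image countable_int)
    then show "negligible ((\<lambda>z. (z - s) / L) ` \<int>)"
      by (simp add: negligible_iff_null_sets null_sets_completionI countable_imp_null_set_lborel)
    fix x assume x: "x \<in> {0..1} - (\<lambda>z. (z - s) / L) ` \<int>"
    show "L ^ (2 * r) * K (L * x) = (deriv ^^ r) (Ndir p n i) x * (deriv ^^ r) (Ndir p n j) x"
      unfolding deriv[OF i x] deriv[OF j x] by (simp add: K_def mult_2 power_add)
  qed
  also have "\<dots> = L ^ (2 * r) * integral {0..1} (\<lambda>x. K (L * x))" by simp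
  also have "integral {0..1} (\<lambda>x. K (L * x)) = (LINT x:{0..1}|lborel. K (L * x))"
  proof (rule set_borel_integral_eq_integral(2)[symmetric])
    have "integrable lborel (\<lambda>x. indicator {0..L} (0 + L * x) * K (0 + L * x))"
      using L by (intro lborel_integrable_real_affine[OF bounded_supp_integrable[OF bK]]) simp
    then show "set_integrable lborel {0..1} (\<lambda>x. K (L * x))"
      unfolding set_integrable_def ind by simp
  qed
  also have "\<dots> = (\<integral>x. indicator {0..L} (0 + L * x) * K (0 + L * x) \<partial>lborel)"
    unfolding set_lebesgue_integral_def ind by simp
  also have "\<dots> = (\<integral>y. indicator {0..L} y * K y \<partial>lborel) / L"
    using lborel_integral_real_affine[of L "\<lambda>y. indicator {0..L} y * K y" 0] L by simp
  also have "(\<integral>y. indicator {0..L} y * K y \<partial>lborel)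
      = autocorr g (real j - real i) - autocorr g (- real j - real i)
        - autocorr g (2 * L - real j - real i)"
    unfolding K_def
  \<comment> \<open>Here \<open>s\<close> is half the support width, with
    \<open>2 * s = p + 1 < L\<close>, and the \<open>r\<close>-th derivative of an even function has
    parity \<open>(-1) ^ r\<close>.\<close>
  proof (rule integral_dirichlet_fold_mult[where s=s and \<epsilon>="(-1) ^ r"])
    show "bounded_supp g" unfolding g_def by (rule bounded_supp_spline_deriv)
    show "g y = 0" if "s < \<bar>y\<bar>" for y
      using that assms(3) unfolding g_def s_def by (intro spline_deriv_eq_0)
    show "AE y in lborel. g (- (y - a)) = (-1) ^ r * g (y - a)" for a
      using AE_notin_Ints_shift[of "s - a"]
    proof eventually_elim
      case (elim y)
      then show ?case
        unfolding g_def s_def using assms(3) by (intro spline_deriv_minus) (simp_all add: algebra_simps)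
    qed
  qed (use i j n in \<open>simp_all add: L_def s_def flip: power_mult_distrib\<close>)
  also have "autocorr g (real j - real i) = alpha p r (nat \<bar>int i - int j\<bar>)"
    unfolding g_def using assms(3) by (intro autocorr_spline_deriv_eq_alpha) auto
  also have "autocorr g (- real j - real i) = alpha p r (i + j)"
    unfolding g_def using assms(3) by (intro autocorr_spline_deriv_eq_alpha) auto
  also have "autocorr g (2 * L - real j - real i) = alpha p r (2 * n + 2 - i - j)"
    unfolding g_def using assms(3) i j
    by (intro autocorr_spline_deriv_eq_alpha) (auto simp: L_def of_nat_diff)
  \<comment> \<open>The divisor \<open>L\<close> comes from the substitution
    \<open>y = L * x\<close>. For \<open>r = 0\<close> the exponent is -1, hence the integer
    power.\<close>
  also have "L ^ (2 * r) * (x / L) = L powi (2 * int r - 1) * x" for x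
  proof -
    have "L powi (2 * int r - 1) = L powi int (2 * r) / L powi 1"
      using L by (subst power_int_diff[symmetric]) auto
    then show ?thesis by (simp only: power_int_of_nat power_int_1_right) simp
  qed
  finally show "Xmat p r n i j = real (n + 1) powi (2 * int r - 1)
      * (toeplitz n (alpha p r) i j - hankel2 n (alpha p r) i j)"
    by (simp add: toeplitz_def hankel2_def L_def)
qed

end
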